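(* Let $X$ be an integer-weighted graph that is weakly Hadamard diagonalizable. Then every eigenvalue of the Laplacian matrix $L(X)$ is an integer.
   Context: Graphs are finite, simple and undirected, with edge weights; "integer-weighted" means all edge weights are integers. The adjacency matrix $A(X)$ has $(i,j)$ entry equal to the weight of the edge $ij$ (and $0$ if there is no edge), $D(X)$ is the diagonal matrix of weighted degrees (sum of weights of incident edges), and $L(X)=D(X)-A(X)$. A weak Hadamard matrix is a real square matrix $P$ with entries in $\{-1,0,1\}$ such that $P^TP$ is tridiagonal. $X$ is weakly Hadamard diagonalizable (WHD) if there is an invertible weak Hadamard matrix $P$ with $P^{-1}L(X)P$ diagonal. *)

theory Defs
  imports Complex_Main "Jordan_Normal_Form.Char_Poly"
begin

section \<open>Weighted graphs and their Laplacian matrices\<close>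

text \<open>The vertices of \<open>X\<close> are \<open>0, \<dots>, num_verts X - 1\<close>, so that they index the rows and columns
  of its matrices. An edge is the two-element set of its ends, hence neither loops nor multiple
  edges occur. Weights are arbitrary reals, and \<open>edge_weight X\<close> is irrelevant off \<open>edges X\<close>.\<close>

record wgraph =
  num_verts :: nat
  edges :: "nat set set"
  edge_weight :: "nat set \<Rightarrow> real"

definition weighted_graph :: "wgraph \<Rightarrow> bool" where
  "weighted_graph X \<longleftrightarrow> (\<forall>e \<in> edges X. e \<subseteq> {..<num_verts X} \<and> card e = 2)"

definition integer_weighted :: "wgraph \<Rightarrow> bool" where
  "integer_weighted X \<longleftrightarrow> (\<forall>e \<in> edges X. edge_weight X e \<in> \<int>)"

definition adjacency_mat :: "wgraph \<Rightarrow> real mat" where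
  "adjacency_mat X = mat (num_verts X) (num_verts X)
     (\<lambda>(i, j). if {i, j} \<in> edges X then edge_weight X {i, j} else 0)"

definition weighted_degree :: "wgraph \<Rightarrow> nat \<Rightarrow> real" where
  "weighted_degree X i = (\<Sum>e | e \<in> edges X \<and> i \<in> e. edge_weight X e)"

definition degree_mat :: "wgraph \<Rightarrow> real mat" where
  "degree_mat X = mat (num_verts X) (num_verts X)
     (\<lambda>(i, j). if i = j then weighted_degree X i else 0)"

definition laplacian_mat :: "wgraph \<Rightarrow> real mat" where
  "laplacian_mat X = degree_mat X - adjacency_mat X"


section \<open>Weak Hadamard matrices\<close>

definition tridiagonal_mat :: "'a::zero mat \<Rightarrow> bool" where
  "tridiagonal_mat A \<longleftrightarrow> square_mat A \<and>
     (\<forall>i < dim_row A. \<forall>j < dim_col A. i + 1 < j \<or> j + 1 < i \<longrightarrow> A $$ (i, j) = 0)"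

definition weak_hadamard_mat :: "real mat \<Rightarrow> bool" where
  "weak_hadamard_mat P \<longleftrightarrow> square_mat P \<and> elements_mat P \<subseteq> {-1, 0, 1} \<and>
     tridiagonal_mat (transpose_mat P * P)"

text \<open>\<open>Q\<close> below is the inverse of \<open>P\<close>.\<close>

definition weakly_hadamard_diagonalizable :: "wgraph \<Rightarrow> bool" where
  "weakly_hadamard_diagonalizable X \<longleftrightarrow>
     (\<exists>P \<in> carrier_mat (num_verts X) (num_verts X).
      \<exists>Q \<in> carrier_mat (num_verts X) (num_verts X).
        weak_hadamard_mat P \<and> inverts_mat P Q \<and> inverts_mat Q P \<and>
        diagonal_mat (Q * laplacian_mat X * P))"

end

theory Submission
  imports Defs
begin

text \<open>The eigenvalues are the diagonal entries of \<open>inverse P * L * P\<close>, with the columns of \<open>P\<close> as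
  eigenvectors. A column of \<open>P\<close> is nonzero with entries in \<open>{-1, 0, 1}\<close>, so it has an entry \<open>\<plusminus>1\<close>;
  at that position the eigenvalue equation exhibits the eigenvalue, up to sign, as an entry of an
  integer matrix times an integer vector.\<close>

text \<open>Similar matrices share their characteristic polynomial, and that of a diagonal matrix is
  the product of the linear factors given by its diagonal. For real \<open>A\<close> these factors
  are real, so the complex roots are already the diagonal entries.\<close>

lemma eigenvalue_of_real_diagonalized:
  fixes A :: "real mat" and \<mu> :: complex
  assumes A: "A \<in> carrier_mat n n" and P: "P \<in> carrier_mat n n" and Q: "Q \<in> carrier_mat n n"
    and PQ: "P * Q = 1\<^sub>m n" and QP: "Q * P = 1\<^sub>m n"
    and diag: "diagonal_mat (Q * A * P)"
    and ev: "eigenvalue (map_mat complex_of_real A) \<mu>"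
  obtains j where "j < n" and "\<mu> = of_real ((Q * A * P) $$ (j, j))"
proof -
  interpret poly_hom: map_poly_comm_ring_hom complex_of_real ..
  define D where "D = Q * A * P"
  have D: "D \<in> carrier_mat n n" using A P Q unfolding D_def by auto
  have "similar_mat_wit D A Q P"
    by (rule similar_mat_witI[OF QP PQ D_def D A Q P])
  then have "similar_mat D A" unfolding similar_mat_def by blast
  then have "char_poly A = char_poly D" by (rule char_poly_similar[symmetric])
  \<comment> \<open>Diagonal matrices are treated as triangular ones, for which the characteristic
    polynomial is known to split along the diagonal.\<close>
  moreover have "upper_triangular D"
    using diag D unfolding D_def[symmetric] diagonal_mat_def upper_triangular_def by auto
  then have "char_poly D = (\<Prod>a\<leftarrow>diag_mat D. [:- a, 1:])"
    by (rule char_poly_upper_triangular[OF D])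
  moreover have "poly (map_poly complex_of_real (char_poly A)) \<mu> = 0"
    using eigenvalue_root_char_poly[of "map_mat complex_of_real A" n \<mu>] ev A
    by (simp add: of_real_hom.char_poly_hom)
  ultimately have "poly (\<Prod>a\<leftarrow>diag_mat D. [:- complex_of_real a, 1:]) \<mu> = 0"
    by (simp add: poly_hom.hom_prod_list o_def)
  then obtain a where "a \<in> set (diag_mat D)" "\<mu> = of_real a"
    by (auto simp: poly_prod_list prod_list_zero_iff o_def)
  then show thesis using that D unfolding D_def[symmetric] by (auto simp: diag_mat_def)
qed

text \<open>The inverse \<open>Q\<close> may have non-integer entries, so integrality cannot be read
  off \<open>Q * A * P\<close>. The equation \<open>A * P = P * D\<close> avoids \<open>Q\<close>:
  its left side is an integer matrix.\<close>

lemma diagonalized_entry_Ints: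
  fixes A :: "real mat"
  assumes A: "A \<in> carrier_mat n n" and P: "P \<in> carrier_mat n n" and Q: "Q \<in> carrier_mat n n"
    and PQ: "P * Q = 1\<^sub>m n" and QP: "Q * P = 1\<^sub>m n"
    and diag: "diagonal_mat (Q * A * P)"
    and A_Ints: "\<And>i k. i < n \<Longrightarrow> k < n \<Longrightarrow> A $$ (i, k) \<in> \<int>"
    and P_entries: "elements_mat P \<subseteq> {-1, 0, 1}"
    and j: "j < n"
  shows "(Q * A * P) $$ (j, j) \<in> \<int>"
proof -
  define D where "D = Q * A * P"
  have D: "D \<in> carrier_mat n n" using A P Q unfolding D_def by auto
  have P_entry: "P $$ (i, k) \<in> {-1, 0, 1}" if "i < n" "k < n" for i k
    using P_entries elements_matI[OF P that refl] by blast
  have "A * P = P * Q * (A * P)" using A P PQ by simp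
  also have "\<dots> = P * D"
    using A P Q unfolding D_def by (simp add: assoc_mult_mat[of _ n n _ n _ n])
  finally have AP: "A * P = P * D" .
  \<comment> \<open>A zero column \<open>j\<close> of \<open>P\<close> would make entry
    \<open>(j, j)\<close> of \<open>Q * P\<close> equal to 0 instead of 1.\<close>
  have "\<exists>i<n. P $$ (i, j) \<noteq> 0"
  proof (rule ccontr)
    assume "\<not> ?thesis"
    then have "(Q * P) $$ (j, j) = 0"
      using P Q j by (simp add: scalar_prod_def)
    then show False using QP j by simp
  qed
  then obtain i where i: "i < n" and nz: "P $$ (i, j) \<noteq> 0" by blast
  have P_Ints: "P $$ (k, j) \<in> \<int>" if "k < n" for k
    using P_entry[OF that j] by auto
  have "(A * P) $$ (i, j) \<in> \<int>"
    using A P i j by (auto simp: scalar_prod_def intro!: Ints_sum Ints_mult A_Ints P_Ints)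
  \<comment> \<open>Since \<open>D\<close> is diagonal, only \<open>k = j\<close> contributes; the
    conditional form lets the simplifier collapse the sum.\<close>
  moreover have "(P * D) $$ (i, j) = (\<Sum>k = 0..<n. if k = j then P $$ (i, j) * D $$ (j, j) else 0)"
  proof -
    have "(P * D) $$ (i, j) = (\<Sum>k = 0..<n. P $$ (i, k) * D $$ (k, j))"
      using P D i j by (simp add: scalar_prod_def)
    also have "\<dots> = (\<Sum>k = 0..<n. if k = j then P $$ (i, j) * D $$ (j, j) else 0)"
      using D j diag unfolding D_def[symmetric] diagonal_mat_def by (intro sum.cong) auto
    finally show ?thesis .
  qed
  ultimately have "P $$ (i, j) * D $$ (j, j) \<in> \<int>" using AP j by simp
  moreover have "P $$ (i, j) = 1 \<or> P $$ (i, j) = -1"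
    using P_entry[OF i j] nz by auto
  ultimately show ?thesis unfolding D_def[symmetric] by auto
qed

lemma laplacian_mat_Ints:
  assumes "integer_weighted X" and "i < num_verts X" and "j < num_verts X"
  shows "laplacian_mat X $$ (i, j) \<in> \<int>"
proof -
  have "weighted_degree X i \<in> \<int>"
    using assms(1) unfolding weighted_degree_def integer_weighted_def by (auto intro: Ints_sum)
  then show ?thesis
    using assms
    by (auto simp: laplacian_mat_def degree_mat_def adjacency_mat_def integer_weighted_def)
qed

text \<open>The Laplacian is cast to the complex numbers so that no eigenvalue is excluded in
  advance; membership in \<open>\<int>\<close> then also says that \<mu> is real.\<close>

theorem theorem3p1:
  fixes X :: wgraph and \<mu> :: complex
  assumes "weighted_graph X"
    and "integer_weighted X"
    and "weakly_hadamard_diagonalizable X"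
    and "eigenvalue (map_mat complex_of_real (laplacian_mat X)) \<mu>"
  shows "\<mu> \<in> \<int>"
proof -
  define n where "n = num_verts X"
  define L where "L = laplacian_mat X"
  have L: "L \<in> carrier_mat n n"
    unfolding L_def n_def laplacian_mat_def degree_mat_def adjacency_mat_def
    by (intro minus_carrier_mat mat_carrier)
  obtain P Q where P: "P \<in> carrier_mat n n" and Q: "Q \<in> carrier_mat n n"
    and entries: "elements_mat P \<subseteq> {-1, 0, 1}"
    and inv: "inverts_mat P Q" "inverts_mat Q P"
    and diag: "diagonal_mat (Q * L * P)"
    using assms(3)
    unfolding weakly_hadamard_diagonalizable_def weak_hadamard_mat_def n_def L_def by blast
  have PQ: "P * Q = 1\<^sub>m n" and QP: "Q * P = 1\<^sub>m n"
    using inv P Q unfolding inverts_mat_def by auto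
  have L_Ints: "L $$ (i, k) \<in> \<int>" if "i < n" "k < n" for i k
    using laplacian_mat_Ints[OF assms(2)] that unfolding L_def n_def by blast
  obtain j where j: "j < n" and \<mu>: "\<mu> = of_real ((Q * L * P) $$ (j, j))"
    using eigenvalue_of_real_diagonalized[OF L P Q PQ QP diag] assms(4) unfolding L_def by blast
  have "(Q * L * P) $$ (j, j) \<in> \<int>"
    by (rule diagonalized_entry_Ints[OF L P Q PQ QP diag L_Ints entries j])
  then show ?thesis unfolding \<mu> by (auto elim: Ints_cases)
qed

end
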